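(* Let $\mathfrak{L}$ be a left or right Leibniz algebra over a field. Then $\mathfrak{L}^{(n)}$ is a (two-sided) ideal of $\mathfrak{L}$ for every non-negative integer $n$.
   Context: An algebra over a field is a vector space with a bilinear multiplication $(x,y)\mapsto xy$, not assumed associative. A left Leibniz algebra is an algebra satisfying $x(yz)=(xy)z+y(xz)$ for all $x,y,z$; a right Leibniz algebra is an algebra satisfying $(xy)z=(xz)y+x(yz)$ for all $x,y,z$. The derived series is defined by $\mathfrak{L}^{(0)}:=\mathfrak{L}$ and $\mathfrak{L}^{(n+1)}:=\mathfrak{L}^{(n)}\mathfrak{L}^{(n)}$, where a product of two subspaces denotes the linear span of all products of their elements. *)

theory Defs
  imports Complex_Main
begin

text \<open>The underlying vector space is the whole type \<open>'b\<close>, with scalar multiplication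
  \<open>scale\<close> over an arbitrary field \<open>'a\<close>. No associativity, unit or finite dimension is assumed.\<close>

locale nonassoc_algebra = vector_space scale
  for scale :: "'a::field \<Rightarrow> 'b::ab_group_add \<Rightarrow> 'b" +
  fixes mult :: "'b \<Rightarrow> 'b \<Rightarrow> 'b" (infixl \<open>\<cdot>\<close> 70)
  assumes linear_mult_right: "Vector_Spaces.linear scale scale (\<lambda>y. x \<cdot> y)"
    and linear_mult_left: "Vector_Spaces.linear scale scale (\<lambda>x. x \<cdot> y)"
begin

definition subspace_prod :: "'b set \<Rightarrow> 'b set \<Rightarrow> 'b set"
  where "subspace_prod A B = span {x \<cdot> y | x y. x \<in> A \<and> y \<in> B}"

definition two_sided_ideal :: "'b set \<Rightarrow> bool"
  where "two_sided_ideal I \<longleftrightarrow> subspace I \<and> (\<forall>x. \<forall>a\<in>I. x \<cdot> a \<in> I \<and> a \<cdot> x \<in> I)"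

primrec derived_series :: "nat \<Rightarrow> 'b set"
  where
    "derived_series 0 = UNIV"
  | "derived_series (Suc n) = subspace_prod (derived_series n) (derived_series n)"

end

locale left_leibniz_algebra = nonassoc_algebra +
  assumes left_leibniz: "x \<cdot> (y \<cdot> z) = (x \<cdot> y) \<cdot> z + y \<cdot> (x \<cdot> z)"

locale right_leibniz_algebra = nonassoc_algebra +
  assumes right_leibniz: "(x \<cdot> y) \<cdot> z = (x \<cdot> z) \<cdot> y + x \<cdot> (y \<cdot> z)"

end

theory Submission imports Defs
begin

text \<open>Induction on \<open>n\<close>: the whole algebra is an ideal, and the square
  \<open>I I\<close> of an ideal \<open>I\<close> is again an ideal. By bilinearity the latter need
  only be tested on products \<open>a \<cdot> b\<close> with \<open>a\<close>, \<open>b\<close> in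
  \<open>I\<close> (\<open>two_sided_ideal_span\<close>). In the left case, left multiplications are
  derivations, so \<open>x (a b) = (x a) b + a (x b)\<close> stays in \<open>I I\<close>; solving
  the same identity for the other side gives \<open>(a b) x = a (b x) - b (a x)\<close>, again in
  \<open>I I\<close>. The right case is the mirror image. The two lemmas
  \<open>two_sided_ideal_square\<close> carry this.\<close>

context nonassoc_algebra
begin

text \<open>Multiplication by a fixed element, on either side, is linear, and a linear map sends the
  span of \<open>S\<close> onto the span of the image of \<open>S\<close>. So absorption passes from
  generators to the span.\<close>

lemma two_sided_ideal_span:
  assumes "\<And>x s. s \<in> S \<Longrightarrow> x \<cdot> s \<in> span S"
    and "\<And>x s. s \<in> S \<Longrightarrow> s \<cdot> x \<in> span S"
  shows "two_sided_ideal (span S)"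
proof -
  have "f ` span S \<subseteq> span S" if "Vector_Spaces.linear scale scale f" "f ` S \<subseteq> span S" for f
  proof -
    interpret f: Vector_Spaces.linear scale scale f by fact
    show ?thesis
      using span_minimal[OF that(2) subspace_span] by (simp add: f.span_image)
  qed
  from this[OF linear_mult_right] this[OF linear_mult_left] show ?thesis
    unfolding two_sided_ideal_def using assms by (simp add: image_subset_iff)
qed

lemma two_sided_ideal_UNIV: "two_sided_ideal UNIV"
  by (simp add: two_sided_ideal_def)

lemma mult_in_subspace_prod: "a \<in> A \<Longrightarrow> b \<in> B \<Longrightarrow> a \<cdot> b \<in> subspace_prod A B"
  unfolding subspace_prod_def by (blast intro: span_base)

lemma two_sided_ideal_subspace_prod:
  assumes "\<And>x a b. a \<in> A \<Longrightarrow> b \<in> B \<Longrightarrow> x \<cdot> (a \<cdot> b) \<in> subspace_prod A B"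
    and "\<And>x a b. a \<in> A \<Longrightarrow> b \<in> B \<Longrightarrow> (a \<cdot> b) \<cdot> x \<in> subspace_prod A B"
  shows "two_sided_ideal (subspace_prod A B)"
  using assms unfolding subspace_prod_def by (intro two_sided_ideal_span) blast+

lemma subspace_subspace_prod: "subspace (subspace_prod A B)"
  by (simp add: subspace_prod_def)

text \<open>Stability of ideals under squaring is kept as a hypothesis so that one induction serves
  both the left and the right case.\<close>

lemma two_sided_ideal_derived_series:
  assumes "\<And>I. two_sided_ideal I \<Longrightarrow> two_sided_ideal (subspace_prod I I)"
  shows "two_sided_ideal (derived_series n)"
  by (induction n) (simp_all add: assms two_sided_ideal_UNIV)

end

text \<open>Absorption of \<open>I I\<close> from the left comes from \<open>x \<cdot> a\<close> and
  \<open>x \<cdot> b\<close> lying in \<open>I\<close>, absorption from the right from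
  \<open>a \<cdot> x\<close> and \<open>b \<cdot> x\<close>.\<close>

lemma (in left_leibniz_algebra) two_sided_ideal_square:
  assumes "two_sided_ideal I"
  shows "two_sided_ideal (subspace_prod I I)"
proof (rule two_sided_ideal_subspace_prod)
  fix x a b assume ab: "a \<in> I" "b \<in> I"
  then have I: "x \<cdot> a \<in> I" "x \<cdot> b \<in> I" "a \<cdot> x \<in> I" "b \<cdot> x \<in> I"
    using assms by (simp_all add: two_sided_ideal_def)
  show "x \<cdot> (a \<cdot> b) \<in> subspace_prod I I"
    unfolding left_leibniz[of x a b]
    by (intro subspace_add subspace_subspace_prod mult_in_subspace_prod ab I)
  \<comment> \<open>The outside factor \<open>x\<close> now takes the last place of the Leibniz
    identity, which is solved for its middle term; each remaining term is a product of two elements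
    of \<open>I\<close>.\<close>
  have "(a \<cdot> b) \<cdot> x = a \<cdot> (b \<cdot> x) - b \<cdot> (a \<cdot> x)"
    using left_leibniz[of a b x] by simp
  then show "(a \<cdot> b) \<cdot> x \<in> subspace_prod I I"
    by (simp add: subspace_diff subspace_subspace_prod mult_in_subspace_prod ab I)
qed

text \<open>Mirror image of the left case: right multiplications are derivations, and the identity
  solved for \<open>x \<cdot> (a \<cdot> b)\<close> handles multiplication from the left.\<close>

lemma (in right_leibniz_algebra) two_sided_ideal_square:
  assumes "two_sided_ideal I"
  shows "two_sided_ideal (subspace_prod I I)"
proof (rule two_sided_ideal_subspace_prod)
  fix x a b assume ab: "a \<in> I" "b \<in> I"
  then have I: "x \<cdot> a \<in> I" "x \<cdot> b \<in> I" "a \<cdot> x \<in> I" "b \<cdot> x \<in> I"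
    using assms by (simp_all add: two_sided_ideal_def)
  show "(a \<cdot> b) \<cdot> x \<in> subspace_prod I I"
    unfolding right_leibniz[of a b x]
    by (intro subspace_add subspace_subspace_prod mult_in_subspace_prod ab I)
  have "x \<cdot> (a \<cdot> b) = (x \<cdot> a) \<cdot> b - (x \<cdot> b) \<cdot> a"
    using right_leibniz[of x a b] by simp
  then show "x \<cdot> (a \<cdot> b) \<in> subspace_prod I I"
    by (simp add: subspace_diff subspace_subspace_prod mult_in_subspace_prod ab I)
qed

theorem proposition2p18:
  fixes scale :: "'a::field \<Rightarrow> 'b::ab_group_add \<Rightarrow> 'b"
    and mult :: "'b \<Rightarrow> 'b \<Rightarrow> 'b"
    and n :: nat
  assumes "left_leibniz_algebra scale mult \<or> right_leibniz_algebra scale mult"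
  shows "nonassoc_algebra.two_sided_ideal scale mult
           (nonassoc_algebra.derived_series scale mult n)"
  using assms
proof
  assume "left_leibniz_algebra scale mult"
  then interpret left_leibniz_algebra scale mult .
  show ?thesis by (intro two_sided_ideal_derived_series two_sided_ideal_square)
next
  assume "right_leibniz_algebra scale mult"
  then interpret right_leibniz_algebra scale mult .
  show ?thesis by (intro two_sided_ideal_derived_series two_sided_ideal_square)
qed

end
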